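(* For integers $n,k\ge 0$ let $t_{n,k}=\binom{n}{k}\,n^{n-k}$ (with $\binom{n}{k}=0$ for $k>n$ and $0^0=1$). Then: (a) The unit-lower-triangular matrix $\mathsf{T}=(t_{n,k})_{n,k\ge 0}$ is totally positive. (b) The Hankel matrix $(t_{n+n',0})_{n,n'\ge 0}=\big((n+n')^{n+n'}\big)_{n,n'\ge 0}$ is totally positive.
   Context: A (finite or infinite) real matrix is totally positive if all of its minors are nonnegative. *)

theory Defs
  imports "Jordan_Normal_Form.Determinant"
begin

text \<open>A matrix with rows and columns indexed by the natural numbers is a function
  \<open>nat \<Rightarrow> nat \<Rightarrow> real\<close>. Its minor of order \<open>m\<close> selects the rows \<open>r 0 < \<dots> < r (m - 1)\<close> and the
  columns \<open>c 0 < \<dots> < c (m - 1)\<close>; only the values of \<open>r\<close> and \<open>c\<close> below \<open>m\<close> matter.\<close>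

definition minor :: "(nat \<Rightarrow> nat \<Rightarrow> real) \<Rightarrow> nat \<Rightarrow> (nat \<Rightarrow> nat) \<Rightarrow> (nat \<Rightarrow> nat) \<Rightarrow> real" where
  "minor A m r c = det (mat m m (\<lambda>(i, j). A (r i) (c j)))"

definition totally_positive :: "(nat \<Rightarrow> nat \<Rightarrow> real) \<Rightarrow> bool" where
  "totally_positive A \<longleftrightarrow>
     (\<forall>m r c. strict_mono_on {..<m} r \<longrightarrow> strict_mono_on {..<m} c \<longrightarrow> 0 \<le> minor A m r c)"

definition unit_lower_triangular :: "(nat \<Rightarrow> nat \<Rightarrow> real) \<Rightarrow> bool" where
  "unit_lower_triangular A \<longleftrightarrow> (\<forall>n. A n n = 1) \<and> (\<forall>n k. n < k \<longrightarrow> A n k = 0)"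

definition hankel_matrix :: "(nat \<Rightarrow> real) \<Rightarrow> nat \<Rightarrow> nat \<Rightarrow> real" where
  "hankel_matrix a = (\<lambda>n n'. a (n + n'))"

text \<open>For \<open>k > n\<close> the subtraction in the exponent truncates, but then the binomial
  coefficient is zero; and \<open>0 ^ 0 = 1\<close> gives \<open>t_entry 0 0 = 1\<close>.\<close>

definition t_entry :: "nat \<Rightarrow> nat \<Rightarrow> real" where
  "t_entry n k = real (n choose k) * real n ^ (n - k)"

end

theory Submission
  imports Defs
begin

text \<open>The exponential generating function of column \<open>k\<close> is \<open>W(x)^k / (k! (1 - W(x)))\<close>, where
  \<open>W = x exp W\<close> is the tree function. In the theory of exponential Riordan arrays this makes every
  row of the matrix \<open>T\<close> the product of the previous row with the fixed matrix \<open>P\<close> of the operator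
  \<open>f \<mapsto> exp(s) (f / (1 - s))'\<close> in the basis \<open>s^k / k!\<close>. The factorization of the operator becomes
  \<open>P = B M\<close> with the binomial matrix \<open>B\<close> and \<open>M\<^sub>l\<^sub>k = (l + 1)! / k!\<close> for \<open>k \<le> l + 1\<close>. Both factors
  are totally positive, so \<open>P\<close> is, and by Cauchy--Binet total positivity is inherited by \<open>T\<close>, by
  the matrix \<open>S\<close> whose \<open>n\<close>-th column is the zeroth column of \<open>P^n\<close>, and by the Hankel
  matrix, which equals \<open>T S\<close>.\<close>

section \<open>Elementary properties of minors\<close>

lemma minor_Leibniz:
  "minor A m r c = (\<Sum>p | p permutes {..<m}. signof p * (\<Prod>i<m. A (r i) (c (p i))))"
proof -
  have "(\<Prod>i = 0..<m. mat m m (\<lambda>(i, j). A (r i) (c j)) $$ (i, p i)) = (\<Prod>i<m. A (r i) (c (p i)))"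
    if "p permutes {..<m}" for p
    using permutes_in_image[OF that] by (auto simp: atLeast0LessThan intro!: prod.cong)
  then show ?thesis
    unfolding minor_def by (subst det_def'[where n = m]) (auto simp: atLeast0LessThan intro!: sum.cong)
qed

lemma minor_cong:
  assumes "\<And>i j. i < m \<Longrightarrow> j < m \<Longrightarrow> A (r i) (c j) = A' (r' i) (c' j)"
  shows "minor A m r c = minor A' m r' c'"
  unfolding minor_def using assms by (intro arg_cong[where f = det]) auto

lemma minor_transpose: "minor (\<lambda>i j. A j i) m c r = minor A m r c"
proof -
  have "mat m m (\<lambda>(i, j). A (r j) (c i)) = transpose_mat (mat m m (\<lambda>(i, j). A (r i) (c j)))"
    by auto
  then show ?thesis
    unfolding minor_def by (simp add: det_transpose[where n = m])
qed

lemma minor_permute_rows: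
  assumes "p permutes {..<m}"
  shows "minor A m (r \<circ> p) c = signof p * minor A m r c"
proof -
  have "mat m m (\<lambda>(i, j). A ((r \<circ> p) i) (c j)) =
      mat m m (\<lambda>(i, j). mat m m (\<lambda>(i, j). A (r i) (c j)) $$ (p i, j))"
    using permutes_in_image[OF assms] by (intro eq_matI) simp_all
  then show ?thesis
    unfolding minor_def using assms by (simp add: det_permute_rows atLeast0LessThan)
qed

lemma minor_permute_cols:
  assumes "p permutes {..<m}"
  shows "minor A m r (c \<circ> p) = signof p * minor A m r c"
  using minor_permute_rows[OF assms, of "\<lambda>i j. A j i" c r] unfolding minor_transpose[of A] .

lemma minor_repeated_row:
  assumes "i < m" "j < m" "i \<noteq> j" "r i = r j"
  shows "minor A m r c = 0"
  unfolding minor_def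
  by (rule det_identical_rows[where n = m and i = i and j = j]) (use assms in \<open>auto simp: vec_eq_iff\<close>)

lemma minor_scale:
  "minor (\<lambda>n k. a n * b k * A n k) m r c = (\<Prod>i<m. a (r i)) * (\<Prod>j<m. b (c j)) * minor A m r c"
proof -
  have "(\<Prod>i<m. b (c (p i))) = (\<Prod>j<m. b (c j))" if "p permutes {..<m}" for p
    using prod.permute[OF that, of "b \<circ> c"] by (simp add: o_def)
  then show ?thesis
    unfolding minor_Leibniz sum_distrib_left
    by (intro sum.cong) (auto simp: prod.distrib)
qed

lemma minor_0 [simp]: "minor A 0 r c = 1"
  unfolding minor_def by simp

lemma minor_Suc_row:
  assumes "\<And>j. j < m \<Longrightarrow> A (r 0) (c (Suc j)) = 0"
  shows "minor A (Suc m) r c = A (r 0) (c 0) * minor A m (r \<circ> Suc) (c \<circ> Suc)"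
proof -
  let ?M = "mat (Suc m) (Suc m) (\<lambda>(i, j). A (r i) (c j))"
  have "det ?M = (\<Sum>j<Suc m. ?M $$ (0, j) * cofactor ?M 0 j)"
    by (rule laplace_expansion_row) auto
  also have "\<dots> = ?M $$ (0, 0) * cofactor ?M 0 0"
    unfolding sum.lessThan_Suc_shift using assms by simp
  also have "cofactor ?M 0 0 = minor A m (r \<circ> Suc) (c \<circ> Suc)"
    unfolding cofactor_def minor_def mat_delete_def by (auto intro!: arg_cong[where f = det])
  finally show ?thesis
    by (simp add: minor_def)
qed

lemma minor_Suc_col:
  assumes "\<And>i. i < m \<Longrightarrow> A (r (Suc i)) (c 0) = 0"
  shows "minor A (Suc m) r c = A (r 0) (c 0) * minor A m (r \<circ> Suc) (c \<circ> Suc)"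
  using minor_Suc_row[of m "\<lambda>i j. A j i" c r] assms unfolding minor_transpose[of A] .

text \<open>The Cauchy--Binet formula in symmetrized form: summing over all functions instead of the
  increasing ones avoids the choice of representatives and counts every term \<open>m!\<close> times.\<close>

lemma Cauchy_Binet:
  assumes C: "\<And>i j. i < m \<Longrightarrow> j < m \<Longrightarrow> C (r i) (c j) = (\<Sum>l<N. A (r i) l * B l (c j))"
  shows "fact m * minor C m r c = (\<Sum>f \<in> {..<m} \<rightarrow>\<^sub>E {..<N}. minor A m r f * minor B m f c)"
proof -
  let ?F = "{..<m} \<rightarrow>\<^sub>E {..<N}" and ?S = "{p. p permutes {..<m}}"
  let ?g = "\<lambda>f. (\<Prod>i<m. A (r i) (f i)) * minor B m f c"
  have "minor C m r c = (\<Sum>p\<in>?S. signof p * (\<Prod>i<m. \<Sum>l<N. A (r i) l * B l (c (p i))))"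
    unfolding minor_Leibniz
  proof (intro sum.cong refl arg_cong2[where f = "(*)"] prod.cong)
    fix p i assume "p \<in> ?S" "i \<in> {..<m}"
    then show "C (r i) (c (p i)) = (\<Sum>l<N. A (r i) l * B l (c (p i)))"
      using permutes_in_image[of p "{..<m}" i] C by auto
  qed
  also have "\<dots> = (\<Sum>p\<in>?S. \<Sum>f\<in>?F. signof p * (\<Prod>i<m. A (r i) (f i) * B (f i) (c (p i))))"
    by (simp add: prod_sum_PiE sum_distrib_left)
  also have "\<dots> = (\<Sum>f\<in>?F. ?g f)"
    by (subst sum.swap) (simp add: minor_Leibniz prod.distrib sum_distrib_left mult_ac)
  finally have eq: "minor C m r c = (\<Sum>f\<in>?F. ?g f)" .
  \<comment> \<open>Reindexing by \<open>f \<circ> p\<close> moves the sign out of the minor of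
    \<open>B\<close>. Summing over all \<open>p\<close> then completes the diagonal product of
    \<open>A\<close> to a minor.\<close>
  have permuted: "(\<Sum>f\<in>?F. signof p * (\<Prod>i<m. A (r i) (f (p i))) * minor B m f c) = minor C m r c"
    if p: "p permutes {..<m}" for p
  proof -
    have in_F: "f \<circ> q \<in> ?F" if "f \<in> ?F" "q permutes {..<m}" for f q
      using that permutes_in_image[OF that(2)] permutes_not_in[OF that(2)]
      by (auto simp: PiE_def Pi_def extensional_def)
    have "(\<Sum>f\<in>?F. ?g f) = (\<Sum>f\<in>?F. ?g (f \<circ> p))"
      by (rule sum.reindex_bij_witness[where i = "\<lambda>f. f \<circ> p" and j = "\<lambda>f. f \<circ> Hilbert_Choice.inv p"])
        (use p in \<open>auto simp: in_F permutes_inv o_assoc[symmetric] permutes_inv_o\<close>)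
    then show ?thesis
      unfolding eq minor_permute_rows[OF p] by (simp add: mult_ac)
  qed
  have "fact m * minor C m r c = (\<Sum>p\<in>?S. minor C m r c)"
    by (simp add: card_permutations)
  also have "\<dots> = (\<Sum>p\<in>?S. \<Sum>f\<in>?F. signof p * (\<Prod>i<m. A (r i) (f (p i))) * minor B m f c)"
    using permuted by (intro sum.cong) auto
  also have "\<dots> = (\<Sum>f\<in>?F. minor A m r f * minor B m f c)"
    by (subst sum.swap) (simp add: minor_Leibniz[of A] sum_distrib_right)
  finally show ?thesis .
qed

section \<open>Total positivity of products\<close>

lemma sorting_permutation:
  fixes f :: "nat \<Rightarrow> nat"
  assumes "inj_on f {..<m}"
  obtains p where "p permutes {..<m}" "strict_mono_on {..<m} (f \<circ> p)"
proof -
  define xs where "xs = sorted_list_of_set (f ` {..<m})"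
  have len: "length xs = m"
    unfolding xs_def using card_image[OF assms] by simp
  have set: "set xs = f ` {..<m}"
    unfolding xs_def by simp
  have strict: "sorted_wrt (<) xs"
    unfolding xs_def by (rule sorted_list_of_set.strict_sorted_key_list_of_set)
  have nth: "bij_betw ((!) xs) {..<m} (f ` {..<m})"
    using bij_betw_nth[of xs "{..<length xs}" "set xs"] strict by (simp add: strict_sorted_iff len set)
  \<comment> \<open>For \<open>i < m\<close>, \<open>p i\<close> is the argument at which
    \<open>f\<close> takes its \<open>i\<close>-th smallest value, counted from 0.\<close>
  define p where "p = (\<lambda>i. if i < m then the_inv_into {..<m} f (xs ! i) else i)"
  have "bij_betw (the_inv_into {..<m} f \<circ> (!) xs) {..<m} {..<m}"
    using nth bij_betw_the_inv_into[OF inj_on_imp_bij_betw[OF assms]] by (rule bij_betw_trans)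
  then have "bij_betw p {..<m} {..<m}"
    by (rule bij_betw_cong[THEN iffD1, rotated]) (simp add: p_def)
  then have p: "p permutes {..<m}"
    by (rule bij_imp_permutes) (auto simp: p_def)
  have nth_p: "(f \<circ> p) i = xs ! i" if "i < m" for i
    using that nth_mem[of i xs] f_the_inv_into_f[OF assms, of "xs ! i"] by (simp add: p_def len set)
  have "strict_mono_on {..<m} (f \<circ> p)"
    by (rule strict_mono_onI)
      (use strict len in \<open>simp add: nth_p sorted_wrt_nth_less del: o_apply\<close>)
  with p show thesis
    by (rule that)
qed

text \<open>In the Cauchy--Binet sum a non-injective \<open>f\<close> contributes 0 through a
  repeated row. For injective \<open>f\<close>, sorting multiplies both minors by the same sign,
  which cancels. The rows \<open>r\<close> and columns \<open>c\<close> stay fixed because the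
  induction for production matrices controls only some rows of \<open>A\<close>.\<close>

lemma minor_mult_nonneg:
  assumes C: "\<And>i j. i < m \<Longrightarrow> j < m \<Longrightarrow> C (r i) (c j) = (\<Sum>l<N. A (r i) l * B l (c j))"
    and A: "\<And>d. strict_mono_on {..<m} d \<Longrightarrow> 0 \<le> minor A m r d"
    and B: "\<And>d. strict_mono_on {..<m} d \<Longrightarrow> 0 \<le> minor B m d c"
  shows "0 \<le> minor C m r c"
proof -
  have "0 \<le> minor A m r f * minor B m f c" for f
  proof (cases "inj_on f {..<m}")
    case True
    then obtain p where p: "p permutes {..<m}" "strict_mono_on {..<m} (f \<circ> p)"
      by (rule sorting_permutation)
    have "minor A m r (f \<circ> p) * minor B m (f \<circ> p) c = minor A m r f * minor B m f c"
      unfolding minor_permute_rows[OF p(1)] minor_permute_cols[OF p(1)]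
      by (cases p rule: sign_cases) auto
    then show ?thesis
      using A[OF p(2)] B[OF p(2)] by (metis mult_nonneg_nonneg)
  next
    case False
    then obtain i j where "i < m" "j < m" "i \<noteq> j" "f i = f j"
      by (auto simp: inj_on_def)
    then show ?thesis
      by (simp add: minor_repeated_row)
  qed
  then have "0 \<le> (\<Sum>f \<in> {..<m} \<rightarrow>\<^sub>E {..<N}. minor A m r f * minor B m f c)"
    by (intro sum_nonneg) auto
  also have "\<dots> = fact m * minor C m r c"
    by (rule Cauchy_Binet[symmetric]) (rule C)
  finally have "0 \<le> fact m * minor C m r c" .
  then show ?thesis
    by (metis fact_gt_zero less_le_not_le zero_le_mult_iff)
qed

text \<open>Only products whose entries are finite sums occur, but the range of summation depends on the
  entry: \<open>P\<close> and \<open>T\<close> have finite rows, and \<open>S\<close> has in general neither finite rows nor finite columns.\<close>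

definition is_product ::
    "(nat \<Rightarrow> nat \<Rightarrow> real) \<Rightarrow> (nat \<Rightarrow> nat \<Rightarrow> real) \<Rightarrow> (nat \<Rightarrow> nat \<Rightarrow> real) \<Rightarrow> bool" where
  "is_product C A B \<longleftrightarrow> (\<forall>n k. \<forall>\<^sub>F N in sequentially. C n k = (\<Sum>l<N. A n l * B l k))"

text \<open>A minor has finitely many entries, so one range of summation serves all of them.\<close>

lemma is_product_minor:
  fixes m :: nat
  assumes "is_product C A B"
  obtains N where "\<And>i j. i < m \<Longrightarrow> j < m \<Longrightarrow> C (r i) (c j) = (\<Sum>l<N. A (r i) l * B l (c j))"
proof -
  have "\<forall>\<^sub>F N in sequentially. \<forall>i\<in>{..<m}. \<forall>j\<in>{..<m}. C (r i) (c j) = (\<Sum>l<N. A (r i) l * B l (c j))"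
    using assms by (intro eventually_ball_finite ballI finite_lessThan) (simp add: is_product_def)
  then show thesis
    using that eventually_happens'[OF sequentially_bot] by blast
qed

lemma totally_positive_mult:
  assumes "is_product C A B" "totally_positive A" "totally_positive B"
  shows "totally_positive C"
  unfolding totally_positive_def
proof (intro allI impI)
  fix m and r c :: "nat \<Rightarrow> nat" assume mono: "strict_mono_on {..<m} r" "strict_mono_on {..<m} c"
  obtain N where N: "\<And>i j. i < m \<Longrightarrow> j < m \<Longrightarrow> C (r i) (c j) = (\<Sum>l<N. A (r i) l * B l (c j))"
    using is_product_minor[OF assms(1)] by blast
  show "0 \<le> minor C m r c"
    by (rule minor_mult_nonneg[of m C r c A B N, OF N])
      (use assms(2,3) mono in \<open>auto simp: totally_positive_def\<close>)
qed

section \<open>Operations preserving total positivity\<close>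

lemma totally_positive_transpose:
  assumes "totally_positive A"
  shows "totally_positive (\<lambda>i j. A j i)"
  using assms unfolding totally_positive_def minor_transpose[of A] by blast

lemma totally_positive_scale:
  assumes "totally_positive A" "\<And>n. 0 \<le> a n" "\<And>k. 0 \<le> b k"
  shows "totally_positive (\<lambda>n k. a n * b k * A n k)"
  using assms by (auto simp: totally_positive_def minor_scale intro!: mult_nonneg_nonneg prod_nonneg)

lemma totally_positive_Suc_rows:
  assumes "totally_positive A"
  shows "totally_positive (\<lambda>n. A (Suc n))"
  unfolding totally_positive_def
proof (intro allI impI)
  fix m and r c :: "nat \<Rightarrow> nat" assume "strict_mono_on {..<m} r" "strict_mono_on {..<m} c"
  then have "0 \<le> minor A m (Suc \<circ> r) c"
    using assms by (auto simp: totally_positive_def strict_mono_on_def)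
  also have "\<dots> = minor (\<lambda>n. A (Suc n)) m r c"
    by (rule minor_cong) simp
  finally show "0 \<le> minor (\<lambda>n. A (Suc n)) m r c" .
qed

lemma strict_mono_on_Suc:
  assumes "strict_mono_on {..<Suc m} (r :: nat \<Rightarrow> nat)"
  shows "strict_mono_on {..<m} (r \<circ> Suc)" "i < m \<Longrightarrow> r 0 < r (Suc i)"
  using assms by (auto simp: strict_mono_on_def)

section \<open>Bidiagonal and production matrices\<close>

definition bidiagonal :: "(nat \<Rightarrow> nat \<Rightarrow> real) \<Rightarrow> bool" where
  "bidiagonal Q \<longleftrightarrow> (\<forall>n k. k \<noteq> n \<longrightarrow> k \<noteq> Suc n \<longrightarrow> Q n k = 0)"

text \<open>In every minor the first row or the first column vanishes outside the top left corner,
  because an entry to the right of it and an entry below it cannot both lie on the two diagonals.\<close>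

lemma totally_positive_bidiagonal:
  assumes Q: "bidiagonal Q" and nonneg: "\<And>n k. 0 \<le> Q n k"
  shows "totally_positive Q"
  unfolding totally_positive_def
proof (intro allI impI)
  fix m and r c :: "nat \<Rightarrow> nat" assume "strict_mono_on {..<m} r" "strict_mono_on {..<m} c"
  then show "0 \<le> minor Q m r c"
  proof (induction m arbitrary: r c)
    case (Suc m)
    note r = strict_mono_on_Suc[OF Suc.prems(1)] and c = strict_mono_on_Suc[OF Suc.prems(2)]
    have "minor Q (Suc m) r c = Q (r 0) (c 0) * minor Q m (r \<circ> Suc) (c \<circ> Suc)"
    proof (cases "r 0 < c 0")
      case True
      then have "Q (r 0) (c (Suc j)) = 0" if "j < m" for j
        using c(2)[OF that] Q by (auto simp: bidiagonal_def)
      then show ?thesis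
        by (rule minor_Suc_row)
    next
      case False
      then have "Q (r (Suc i)) (c 0) = 0" if "i < m" for i
        using r(2)[OF that] Q by (auto simp: bidiagonal_def)
      then show ?thesis
        by (rule minor_Suc_col)
    qed
    then show ?case
      using mult_nonneg_nonneg[OF nonneg Suc.IH[OF r(1) c(1)]] by (simp only:)
  qed simp
qed

lemma sum_bidiagonal:
  assumes "bidiagonal Q" "k < N"
  shows "(\<Sum>l<N. a l * Q l k) = a k * Q k k + (if k = 0 then 0 else a (k - 1) * Q (k - 1) k)"
proof -
  \<comment> \<open>For \<open>k = 0\<close> truncated subtraction collapses the index set to a
    single point.\<close>
  have "(\<Sum>l<N. a l * Q l k) = (\<Sum>l\<in>{k - 1, k}. a l * Q l k)"
    using assms by (intro sum.mono_neutral_right) (auto simp: bidiagonal_def)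
  also have "\<dots> = a k * Q k k + (if k = 0 then 0 else a (k - 1) * Q (k - 1) k)"
    by (cases k) auto
  finally show ?thesis .
qed

text \<open>In the situation of the next lemma the matrix \<open>P\<close> is called the production matrix
  of \<open>A\<close>. The induction bounds the largest row index in the minor.\<close>

lemma totally_positive_production:
  assumes row_0: "\<And>k. A 0 k = (if k = 0 then 1 else 0)"
    and prod: "is_product (\<lambda>n. A (Suc n)) A P"
    and P: "totally_positive P"
  shows "totally_positive A"
proof -
  have "0 \<le> minor A m r c"
    if "strict_mono_on {..<m} r" "strict_mono_on {..<m} c" "\<forall>i<m. r i < b" for b m r c
    using that
  proof (induction b arbitrary: m r c)
    case 0
    then have "m = 0" by auto
    then show ?case by simp
  next
    case (Suc b)
    \<comment> \<open>Without row 0, every selected row is the preceding row times \<open>P\<close>,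
      so the induction hypothesis applies to the row indices lowered by one.\<close>
    have pos_rows: "0 \<le> minor A m r c"
      if mono: "strict_mono_on {..<m} r" "strict_mono_on {..<m} c" and r: "\<forall>i<m. 0 < r i \<and> r i < Suc b"
      for m r c
    proof -
      let ?r = "\<lambda>i. r i - 1"
      have mono': "strict_mono_on {..<m} ?r"
        using mono r by (auto simp: strict_mono_on_def intro!: diff_less_mono Suc_leI)
      obtain N where N: "\<And>i j. i < m \<Longrightarrow> j < m \<Longrightarrow>
          A (Suc (?r i)) (c j) = (\<Sum>l<N. A (?r i) l * P l (c j))"
        using is_product_minor[OF prod, of m ?r c] by blast
      have "0 \<le> minor (\<lambda>n. A (Suc n)) m ?r c"
      proof (rule minor_mult_nonneg[of m "\<lambda>n. A (Suc n)" ?r c A P N, OF N])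
        fix d :: "nat \<Rightarrow> nat" assume d: "strict_mono_on {..<m} d"
        show "0 \<le> minor A m ?r d"
          using r by (intro Suc.IH mono' d) (auto simp: less_Suc_eq_le Suc_le_eq)
        show "0 \<le> minor P m d c"
          using P d mono(2) by (auto simp: totally_positive_def)
      qed
      also have "\<dots> = minor A m r c"
        using r by (intro minor_cong) auto
      finally show ?thesis .
    qed
    show ?case
    proof (cases "m = 0 \<or> 0 < r 0")
      case True
      then have "\<forall>i<m. 0 < r i"
        using Suc.prems(1) by (auto simp: strict_mono_on_def) (metis gr_zeroI less_nat_zero_code)
      then show ?thesis
        using Suc.prems by (intro pos_rows) auto
    next
      case False
      then obtain k where m: "m = Suc k" and r0: "r 0 = 0"
        by (cases m) auto
      note r = strict_mono_on_Suc[OF Suc.prems(1)[unfolded m]]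
        and c = strict_mono_on_Suc[OF Suc.prems(2)[unfolded m]]
      \<comment> \<open>With row 0 selected, only the corner of the first row can be nonzero, and
        expansion leaves a minor without row 0.\<close>
      have "A (r 0) (c (Suc j)) = 0" if "j < k" for j
        using c(2)[OF that] by (simp add: r0 row_0)
      then have "minor A m r c = A (r 0) (c 0) * minor A k (r \<circ> Suc) (c \<circ> Suc)"
        unfolding m by (rule minor_Suc_row)
      moreover have "0 \<le> minor A k (r \<circ> Suc) (c \<circ> Suc)"
        using r(2) Suc.prems(3) m by (intro pos_rows r(1) c(1)) (auto simp: r0)
      ultimately show ?thesis
        by (simp add: r0 row_0)
    qed
  qed
  moreover have "\<exists>b. \<forall>i<m. r i < b" for m and r :: "nat \<Rightarrow> nat"
    by (rule exI[of _ "Suc (\<Sum>i<m. r i)"]) (auto simp: less_Suc_eq_le intro: member_le_sum)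
  ultimately show ?thesis
    unfolding totally_positive_def by blast
qed

section \<open>The all-ones triangle and the binomial matrix\<close>

lemma totally_positive_all_ones: "totally_positive (\<lambda>n k. if k \<le> n then 1 else 0)"
proof (rule totally_positive_production)
  \<comment> \<open>Multiplication by \<open>?Q\<close> shifts a row one place to the right and also
    keeps its entry in column 0.\<close>
  let ?Q = "\<lambda>n k. if k = Suc n \<or> n = 0 \<and> k = 0 then 1 else 0 :: real"
  have Q: "bidiagonal ?Q"
    by (auto simp: bidiagonal_def)
  then show "totally_positive ?Q"
    by (rule totally_positive_bidiagonal) auto
  show "is_product (\<lambda>n k. if k \<le> Suc n then 1 else 0) (\<lambda>n k. if k \<le> n then 1 else 0) ?Q"
    unfolding is_product_def
  proof (intro allI)
    fix n k :: nat
    show "\<forall>\<^sub>F N in sequentially. (if k \<le> Suc n then 1 else 0) =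
        (\<Sum>l<N. (if l \<le> n then 1 else 0) * ?Q l k)"
      using eventually_gt_at_top[of k]
      by eventually_elim (subst sum_bidiagonal[OF Q], auto)
  qed
qed auto

text \<open>Pascal's rule gives a bidiagonal production matrix.\<close>

lemma totally_positive_binomial: "totally_positive (\<lambda>n k. real (n choose k))"
proof (rule totally_positive_production)
  let ?Q = "\<lambda>n k. if k = n \<or> k = Suc n then 1 else 0 :: real"
  have Q: "bidiagonal ?Q"
    by (auto simp: bidiagonal_def)
  then show "totally_positive ?Q"
    by (rule totally_positive_bidiagonal) auto
  show "is_product (\<lambda>n k. real (Suc n choose k)) (\<lambda>n k. real (n choose k)) ?Q"
    unfolding is_product_def
  proof (intro allI)
    fix n k :: nat
    show "\<forall>\<^sub>F N in sequentially. real (Suc n choose k) = (\<Sum>l<N. real (n choose l) * ?Q l k)"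
      using eventually_gt_at_top[of k]
      by eventually_elim (subst sum_bidiagonal[OF Q], auto simp: choose_reduce_nat)
  qed
qed (auto simp: binomial_eq_0)

section \<open>The production matrix\<close>

definition fact_quotient :: "nat \<Rightarrow> nat \<Rightarrow> real" where
  "fact_quotient l k = (if k \<le> Suc l then fact (Suc l) / fact k else 0)"

text \<open>This is \<open>P\<close>, and \<open>fact_quotient\<close> is \<open>M\<close>; the
  support of \<open>M\<close> extends to \<open>k = l + 1\<close> because differentiation lowers the
  degree by one.\<close>

definition t_production :: "nat \<Rightarrow> nat \<Rightarrow> real" where
  "t_production n k = (\<Sum>l\<le>n. real (n choose l) * fact_quotient l k)"

text \<open>Dropping the first row of the all-ones triangle gives the support; scaling rows by
  \<open>(l + 1)!\<close> and columns by \<open>1 / k!\<close> gives the entries.\<close>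

lemma totally_positive_fact_quotient: "totally_positive fact_quotient"
proof -
  have "fact_quotient = (\<lambda>l k. fact (Suc l) * inverse (fact k) * (if k \<le> Suc l then 1 else 0))"
    by (auto simp: fun_eq_iff fact_quotient_def divide_inverse)
  moreover have "totally_positive \<dots>"
    using totally_positive_Suc_rows[OF totally_positive_all_ones]
    by (rule totally_positive_scale[where a = "\<lambda>l. fact (Suc l)" and b = "\<lambda>k. inverse (fact k)"]) auto
  ultimately show ?thesis
    by simp
qed

lemma totally_positive_t_production: "totally_positive t_production"
proof (rule totally_positive_mult[OF _ totally_positive_binomial totally_positive_fact_quotient])
  show "is_product t_production (\<lambda>n k. real (n choose k)) fact_quotient"
    unfolding is_product_def
  proof (intro allI)
    fix n k
    show "\<forall>\<^sub>F N in sequentially. t_production n k = (\<Sum>l<N. real (n choose l) * fact_quotient l k)"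
      using eventually_gt_at_top[of n]
    proof eventually_elim
      case (elim N)
      then show ?case
        unfolding t_production_def by (intro sum.mono_neutral_left) (auto simp: binomial_eq_0)
    qed
  qed
qed

lemma t_production_eq_0: "t_production n k = 0" if "Suc n < k"
  using that by (auto simp: t_production_def fact_quotient_def intro!: sum.neutral)

section \<open>The recurrence between rows of \<open>T\<close>\<close>

lemma t_entry_eq_0: "t_entry n k = 0" if "n < k"
  using that by (simp add: t_entry_def binomial_eq_0)

text \<open>This evaluates \<open>T B\<close>: rewriting the product of binomial coefficients pulls
  out \<open>n choose l\<close>, and the binomial theorem sums the rest to a power of
  \<open>1 + n\<close>.\<close>

lemma sum_t_entry_binomial:
  assumes "l \<le> n"
  shows "(\<Sum>j\<le>n. t_entry n j * real (j choose l)) = real (n choose l) * real (Suc n) ^ (n - l)"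
proof -
  have "(\<Sum>j\<le>n. t_entry n j * real (j choose l)) = (\<Sum>j\<in>{l..n}. t_entry n j * real (j choose l))"
    by (intro sum.mono_neutral_right) (auto simp: binomial_eq_0)
  also have "\<dots> = (\<Sum>i\<le>n - l. t_entry n (i + l) * real ((i + l) choose l))"
    using assms
    by (intro sum.reindex_bij_witness[where i = "\<lambda>i. i + l" and j = "\<lambda>j. j - l"]) auto
  also have "\<dots> = (\<Sum>i\<le>n - l. real (n choose l) * (real (n - l choose i) * real n ^ (n - l - i)))"
  proof (intro sum.cong refl)
    fix i assume "i \<in> {..n - l}"
    then have "(n choose (i + l)) * ((i + l) choose l) = (n choose l) * (n - l choose i)"
      using assms choose_mult[of l "i + l" n] by auto
    then have "real (n choose (i + l)) * real ((i + l) choose l) = real (n choose l) * real (n - l choose i)"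
      by (metis of_nat_mult)
    then show "t_entry n (i + l) * real ((i + l) choose l) =
        real (n choose l) * (real (n - l choose i) * real n ^ (n - l - i))"
      by (simp add: t_entry_def mult_ac add.commute)
  qed
  also have "\<dots> = real (n choose l) * (1 + real n) ^ (n - l)"
    using binomial_ring[of 1 "real n" "n - l"] by (simp add: sum_distrib_left)
  finally show ?thesis
    by (simp add: add.commute)
qed

text \<open>Applied with \<open>x = n + 1\<close> and \<open>i = n - l\<close>, so that \<open>x - i\<close> is the quotient of \<open>(l + 1)!\<close>
  by \<open>l!\<close>.\<close>

lemma sum_power_fact_telescope:
  fixes x :: real
  shows "(\<Sum>i\<le>p. (x - real i) * x ^ i / fact i) = x ^ Suc p / fact p"
proof (induction p)
  case (Suc p)
  have "x ^ Suc p / fact p = real (Suc p) * x ^ Suc p / fact (Suc p)"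
    by (simp add: divide_simps)
  with Suc show ?case
    by (simp add: left_diff_distrib add_divide_distrib diff_divide_distrib)
qed simp

text \<open>The right side is an entry of \<open>(T B) M\<close>; substituting
  \<open>i = n - l\<close> makes the sum telescope.\<close>

lemma t_entry_Suc_fact_quotient:
  "t_entry (Suc n) k = (\<Sum>l\<le>n. real (n choose l) * real (Suc n) ^ (n - l) * fact_quotient l k)"
proof (cases "k \<le> Suc n")
  case False
  then show ?thesis
    by (auto simp: t_entry_eq_0 fact_quotient_def intro!: sum.neutral[symmetric])
next
  case True
  let ?x = "real (Suc n)"
  \<comment> \<open>The largest \<open>n - l\<close> with \<open>k \<le> l + 1\<close>: the least
    such \<open>l\<close> is \<open>k - 1\<close>, or 0 when \<open>k = 0\<close>.\<close>
  define p where "p = (if k = 0 then n else Suc n - k)"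
  have "(\<Sum>l\<le>n. real (n choose l) * ?x ^ (n - l) * fact_quotient l k) =
      (\<Sum>i\<le>n. real (n choose (n - i)) * ?x ^ i * fact_quotient (n - i) k)"
    by (intro sum.reindex_bij_witness[where i = "\<lambda>i. n - i" and j = "\<lambda>i. n - i"]) auto
  also have "\<dots> = (\<Sum>i\<le>p. real (n choose (n - i)) * ?x ^ i * fact_quotient (n - i) k)"
    using True by (intro sum.mono_neutral_right) (auto simp: p_def fact_quotient_def split: if_splits)
  also have "\<dots> = (\<Sum>i\<le>p. fact n / fact k * ((?x - real i) * ?x ^ i / fact i))"
  proof (intro sum.cong refl)
    fix i assume "i \<in> {..p}"
    then have i: "i \<le> n" "k \<le> Suc (n - i)"
      using True by (auto simp: p_def split: if_splits)
    have "?x - real i = real (Suc (n - i))"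
      using i by (simp add: of_nat_diff)
    moreover have "real (n choose (n - i)) = fact n / (fact (n - i) * fact i)"
      using i binomial_fact[of "n - i" n, where 'a = real] by simp
    ultimately show "real (n choose (n - i)) * ?x ^ i * fact_quotient (n - i) k =
        fact n / fact k * ((?x - real i) * ?x ^ i / fact i)"
      using i by (simp add: fact_quotient_def mult_ac del: of_nat_Suc)
  qed
  also have "\<dots> = fact n / fact k * (?x ^ Suc p / fact p)"
    by (simp only: sum_distrib_left[symmetric] sum_power_fact_telescope)
  \<comment> \<open>For \<open>k = 0\<close> the factorials of \<open>n\<close> cancel; for
    \<open>k > 0\<close> one factor \<open>n + 1\<close> of the power completes \<open>n!\<close> to
    \<open>(n + 1)!\<close>.\<close>
  also have "\<dots> = t_entry (Suc n) k"
  proof (cases "k = 0")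
    case True
    then show ?thesis
      by (simp add: p_def t_entry_def)
  next
    case False
    then show ?thesis
      using \<open>k \<le> Suc n\<close>
      by (simp add: p_def t_entry_def binomial_fact[where 'a = real] del: of_nat_Suc)
  qed
  finally show ?thesis
    by simp
qed

text \<open>Associativity, \<open>T (B M) = (T B) M\<close>, reduces this to the two evaluations
  above.\<close>

lemma t_entry_Suc: "t_entry (Suc n) k = (\<Sum>j\<le>n. t_entry n j * t_production j k)"
proof -
  \<comment> \<open>A range of \<open>l\<close> that does not depend on \<open>j\<close> allows the
    sums to be swapped.\<close>
  have "t_production j k = (\<Sum>l\<le>n. real (j choose l) * fact_quotient l k)" if "j \<le> n" for j
    unfolding t_production_def using that by (intro sum.mono_neutral_left) (auto simp: binomial_eq_0)
  then have "(\<Sum>j\<le>n. t_entry n j * t_production j k) =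
      (\<Sum>j\<le>n. \<Sum>l\<le>n. t_entry n j * real (j choose l) * fact_quotient l k)"
    by (simp add: sum_distrib_left mult_ac)
  also have "\<dots> = (\<Sum>l\<le>n. (\<Sum>j\<le>n. t_entry n j * real (j choose l)) * fact_quotient l k)"
    by (subst sum.swap) (simp add: sum_distrib_right)
  also have "\<dots> = t_entry (Suc n) k"
    unfolding t_entry_Suc_fact_quotient by (intro sum.cong) (auto simp: sum_t_entry_binomial)
  finally show ?thesis by simp
qed

lemma t_entry_0: "t_entry 0 k = (if k = 0 then 1 else 0)"
  by (simp add: t_entry_def binomial_eq_0)

section \<open>Total positivity of \<open>T\<close> and of the Hankel matrix\<close>

lemma totally_positive_t_entry: "totally_positive t_entry"
proof (rule totally_positive_production[where P = t_production])
  show "is_product (\<lambda>n. t_entry (Suc n)) t_entry t_production"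
    unfolding is_product_def
  proof (intro allI)
    fix n k
    show "\<forall>\<^sub>F N in sequentially. t_entry (Suc n) k = (\<Sum>l<N. t_entry n l * t_production l k)"
      using eventually_gt_at_top[of n]
      by eventually_elim
        (unfold t_entry_Suc, intro sum.mono_neutral_left, auto simp: t_entry_eq_0)
  qed
qed (rule t_entry_0 totally_positive_t_production)+

text \<open>Row \<open>n\<close> is the zeroth column of the \<open>n\<close>-th power of the production matrix.\<close>

fun production_col :: "nat \<Rightarrow> nat \<Rightarrow> real" where
  "production_col 0 k = (if k = 0 then 1 else 0)"
| "production_col (Suc n) k = (\<Sum>l\<le>Suc k. t_production k l * production_col n l)"

text \<open>By its recursion, \<open>production_col\<close> has the transpose of \<open>P\<close> as
  production matrix.\<close>

lemma totally_positive_production_col: "totally_positive production_col"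
proof (rule totally_positive_production)
  show "totally_positive (\<lambda>l k. t_production k l)"
    by (rule totally_positive_transpose[OF totally_positive_t_production])
  show "is_product (\<lambda>n. production_col (Suc n)) production_col (\<lambda>l k. t_production k l)"
    unfolding is_product_def
  proof (intro allI)
    fix n k
    show "\<forall>\<^sub>F N in sequentially.
        production_col (Suc n) k = (\<Sum>l<N. production_col n l * t_production k l)"
      using eventually_gt_at_top[of "Suc k"]
    proof eventually_elim
      case (elim N)
      then show ?case
        unfolding production_col.simps mult.commute[of "production_col n _"]
        by (intro sum.mono_neutral_left) (auto simp: t_production_eq_0)
    qed
  qed
qed simp

text \<open>Row \<open>n\<close> of \<open>T\<close> is row 0 of \<open>P^n\<close>, so both sides
  are the corner entry of \<open>P^(n + n')\<close>. The induction moves one factor \<open>P\<close>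
  at a time from the row to the column, which is why \<open>n\<close> varies.\<close>

lemma t_entry_add_0: "t_entry (n + n') 0 = (\<Sum>k\<le>n. t_entry n k * production_col n' k)"
proof (induction n' arbitrary: n)
  case 0
  have "(\<Sum>k\<le>n. t_entry n k * production_col 0 k) = (\<Sum>k\<in>{0}. t_entry n k * production_col 0 k)"
    by (intro sum.mono_neutral_right) auto
  then show ?case by simp
next
  case (Suc n')
  have "t_entry (n + Suc n') 0 = (\<Sum>k\<le>Suc n. t_entry (Suc n) k * production_col n' k)"
    using Suc.IH[of "Suc n"] by simp
  also have "\<dots> = (\<Sum>l\<le>n. t_entry n l * (\<Sum>k\<le>Suc n. t_production l k * production_col n' k))"
    unfolding t_entry_Suc sum_distrib_right sum_distrib_left
    by (subst sum.swap) (simp add: mult_ac)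
  also have "\<dots> = (\<Sum>l\<le>n. t_entry n l * production_col (Suc n') l)"
  proof (intro sum.cong refl arg_cong2[where f = "(*)"])
    fix l assume "l \<in> {..n}"
    then show "(\<Sum>k\<le>Suc n. t_production l k * production_col n' k) = production_col (Suc n') l"
      unfolding production_col.simps
      by (intro sum.mono_neutral_right) (auto simp: t_production_eq_0)
  qed
  finally show ?case .
qed

lemma totally_positive_hankel_t_entry: "totally_positive (hankel_matrix (\<lambda>n. t_entry n 0))"
proof (rule totally_positive_mult[OF _ totally_positive_t_entry
      totally_positive_transpose[OF totally_positive_production_col]])
  show "is_product (hankel_matrix (\<lambda>n. t_entry n 0)) t_entry (\<lambda>i j. production_col j i)"
    unfolding is_product_def
  proof (intro allI)
    fix n n'
    show "\<forall>\<^sub>F N in sequentially.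
        hankel_matrix (\<lambda>n. t_entry n 0) n n' = (\<Sum>l<N. t_entry n l * production_col n' l)"
      using eventually_gt_at_top[of n]
      by eventually_elim
        (unfold hankel_matrix_def t_entry_add_0, intro sum.mono_neutral_left, auto simp: t_entry_eq_0)
  qed
qed

theorem theorem1p1:
  shows "(unit_lower_triangular t_entry \<and> totally_positive t_entry) \<and>
         (hankel_matrix (\<lambda>n. t_entry n 0) = (\<lambda>n n'. real (n + n') ^ (n + n')) \<and>
          totally_positive (hankel_matrix (\<lambda>n. t_entry n 0)))"
proof (intro conjI)
  show "unit_lower_triangular t_entry"
    by (simp add: unit_lower_triangular_def t_entry_eq_0) (simp add: t_entry_def)
  show "hankel_matrix (\<lambda>n. t_entry n 0) = (\<lambda>n n'. real (n + n') ^ (n + n'))"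
    by (simp add: hankel_matrix_def t_entry_def fun_eq_iff)
qed (rule totally_positive_t_entry totally_positive_hankel_t_entry)+

end
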